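(* Let $m,n\ge 1$ be integers, let $A\in\mathbb{Z}^{m\times n}$ and $b\in\mathbb{Z}^m$ satisfy $A_{ij}\ge 0$ and $b_i>0$ for all $i=1,\ldots,m$, $j=1,\ldots,n$, and let $Q=\{x\in\mathbb{R}^n : x\ge 0,\ Ax\ge b\}$. Then the aggregation closure $$\mathcal{A}(Q)=\bigcap_{\lambda\in\mathbb{R}^m_+}\operatorname{conv}\{Q^\lambda\cap\mathbb{Z}^n\},\qquad Q^\lambda=\{x\in\mathbb{R}^n : x\ge 0,\ \lambda^TAx\ge\lambda^Tb\},$$ is a polyhedron.
   Context: $\mathbb{R}^m_+$ denotes the set of vectors in $\mathbb{R}^m$ with nonnegative entries; inequalities between vectors are componentwise; $\operatorname{conv}$ denotes convex hull. The multipliers $\lambda$ are arbitrary nonnegative real vectors (not necessarily rational). A polyhedron is an intersection of finitely many closed halfspaces of $\mathbb{R}^n$ (possibly empty). A covering integer program is one with feasible region $\{x\in\mathbb{Z}^n : x\ge0,\ Ax\ge b\}$ with $A,b$ as in the claim. *)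

theory Defs
  imports "HOL-Analysis.Analysis"
begin

definition real_vec :: "int ^ 'n \<Rightarrow> real ^ 'n" where
  "real_vec v = (\<chi> j. real_of_int (v $ j))"

definition real_mat :: "int ^ 'n ^ 'm \<Rightarrow> real ^ 'n ^ 'm" where
  "real_mat A = (\<chi> i j. real_of_int (A $ i $ j))"

definition integer_points :: "(real ^ 'n) set" where
  "integer_points = {x. \<forall>j. x $ j \<in> \<int>}"

definition covering_region :: "real ^ 'n ^ 'm \<Rightarrow> real ^ 'm \<Rightarrow> (real ^ 'n) set" where
  "covering_region A b = {x. 0 \<le> x \<and> b \<le> A *v x}"

definition aggregated_region ::
    "real ^ 'n ^ 'm \<Rightarrow> real ^ 'm \<Rightarrow> real ^ 'm \<Rightarrow> (real ^ 'n) set" where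
  "aggregated_region A b l = {x. 0 \<le> x \<and> l \<bullet> b \<le> (l v* A) \<bullet> x}"

lemma covering_region_subset_aggregated_region:
  assumes "0 \<le> l"
  shows "covering_region A b \<subseteq> aggregated_region A b l"
proof
  fix x assume x: "x \<in> covering_region A b"
  have "l \<bullet> b \<le> l \<bullet> (A *v x)"
    using x assms
    by (auto simp: covering_region_def inner_vec_def less_eq_vec_def intro!: sum_mono mult_left_mono)
  also have "\<dots> = (l v* A) \<bullet> x"
    by (simp add: dot_lmul_matrix)
  finally show "x \<in> aggregated_region A b l"
    using x by (simp add: covering_region_def aggregated_region_def)
qed

(* The closure of the region covering_region A b. The multipliers act on the
   rows of the given system, so the data (A, b) are the arguments rather than
   the region as a set. *)
definition aggregation_closure :: "real ^ 'n ^ 'm \<Rightarrow> real ^ 'm \<Rightarrow> (real ^ 'n) set" where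
  "aggregation_closure A b =
     (\<Inter>l \<in> {l. 0 \<le> l}. convex hull (aggregated_region A b l \<inter> integer_points))"

end

theory Submission
  imports Defs
begin

text \<open>
  The integer points of each \<open>Q\<^sup>\<lambda>\<close> form an up-set of \<open>\<nat>\<^sup>n\<close>, and the intersection of the convex hulls
  of any family \<open>\<F>\<close> of up-sets is a polyhedron. By Dickson's lemma an up-set has finitely many
  minimal points, so its hull is a polyhedron. Call \<open>T\<close> a limit of \<open>\<F>\<close> if on every finite set it
  agrees with a member of \<open>\<F>\<close>. The sets containing the minimal points of a limit \<open>T\<close> form an open
  neighbourhood of \<open>T\<close> in the compact space of all sets, so there are finitely many limits such
  that each member of \<open>\<F>\<close> contains one of them. Conversely the hull of a limit \<open>T\<close> contains the
  intersection of the hulls of \<open>\<F>\<close>: a point outside is cut off by an inequality \<open>a \<bullet> x \<ge> \<alpha>\<close>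
  with \<open>a > 0\<close> that is valid for \<open>T\<close>; only finitely many points of \<open>\<nat>\<^sup>n\<close> violate it, so it is
  valid for the members of \<open>\<F>\<close> that agree with \<open>T\<close> on these points.
\<close>

section \<open>Limits of families of sets\<close>

text \<open>Membership of \<open>T\<close> in the closure of \<open>\<F>\<close> in the product
  topology, with sets viewed as predicates \<open>'a \<Rightarrow> bool\<close>; the finite sets
  \<open>P\<close> give the basic neighbourhoods.\<close>

definition limit_set :: "'a set set \<Rightarrow> 'a set \<Rightarrow> bool" where
  "limit_set \<F> T \<longleftrightarrow> (\<forall>P. finite P \<longrightarrow> (\<exists>S\<in>\<F>. S \<inter> P = T \<inter> P))"

lemma limit_setE:
  assumes "limit_set \<F> T" "finite P"
  obtains S where "S \<in> \<F>" "S \<inter> P = T \<inter> P"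
  using assms unfolding limit_set_def by blast

text \<open>Tychonoff's theorem for a power of the finite space \<open>bool\<close>.\<close>

lemma compact_UNIV_fun_bool: "compact (UNIV :: ('a \<Rightarrow> bool) set)"
proof -
  have "compactin (product_topology (\<lambda>i. euclidean :: bool topology) (UNIV :: 'a set))
      (PiE UNIV (\<lambda>i. UNIV))"
    unfolding compactin_PiE by (simp add: finite_imp_compact)
  then show ?thesis
    by (simp add: euclidean_product_topology PiE_UNIV_domain)
qed

lemma open_fun_bool_agree:
  fixes p :: "'a \<Rightarrow> bool"
  assumes "finite P"
  shows "open {q. \<forall>x\<in>P. q x = p x}"
  using product_topology_basis'[of P "\<lambda>x. {p x}" id] assms by (simp add: open_discrete)

text \<open>Compactness: the sets containing \<open>G T\<close> form an open neighbourhood of the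
  limit \<open>T\<close>, and finitely many of these neighbourhoods cover the closure of
  \<open>\<F>\<close>. Later \<open>G\<close> is \<open>minimal_points\<close>.\<close>

lemma finite_limits_below:
  assumes G: "\<And>T. limit_set \<F> T \<Longrightarrow> finite (G T) \<and> G T \<subseteq> T"
  obtains \<T> where "finite \<T>" "\<And>T. T \<in> \<T> \<Longrightarrow> limit_set \<F> T"
    "\<And>S. S \<in> \<F> \<Longrightarrow> \<exists>T\<in>\<T>. G T \<subseteq> S"
proof -
  define K where "K = closure ((\<lambda>S x. x \<in> S) ` \<F>)"
  have "compact K"
    using compact_Int_closed[OF compact_UNIV_fun_bool, of K] by (simp add: K_def)
  \<comment> \<open>Open since \<open>G\<close> of a limit is finite, and a neighbourhood of
    \<open>p\<close> since \<open>G T \<subseteq> T\<close>. Writing \<open>= True\<close> gives it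
    the form of \<open>open_fun_bool_agree\<close>.\<close>
  define U where "U p = {q. \<forall>x\<in>G (Collect p). q x = True}" for p :: "'a \<Rightarrow> bool"
  have lim: "limit_set \<F> (Collect p)" if "p \<in> K" for p
    unfolding limit_set_def
  proof (intro allI impI)
    fix P :: "'a set" assume "finite P"
    then have "open {q. \<forall>x\<in>P. q x = p x}"
      by (rule open_fun_bool_agree)
    moreover have "p \<in> {q. \<forall>x\<in>P. q x = p x}" by simp
    ultimately have "{q. \<forall>x\<in>P. q x = p x} \<inter> (\<lambda>S x. x \<in> S) ` \<F> \<noteq> {}"
      using \<open>p \<in> K\<close> open_Int_closure_eq_empty unfolding K_def by blast
    then obtain S where "S \<in> \<F>" "\<forall>x\<in>P. (x \<in> S) = p x" by auto
    then show "\<exists>S\<in>\<F>. S \<inter> P = Collect p \<inter> P" by blast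
  qed
  have "open (U p)" if "p \<in> K" for p
    unfolding U_def using G[OF lim[OF that]] by (intro open_fun_bool_agree) blast
  moreover have "K \<subseteq> (\<Union>p\<in>K. U p)"
    using G[OF lim] by (force simp: U_def)
  ultimately obtain C where C: "C \<subseteq> K" "finite C" "K \<subseteq> (\<Union>p\<in>C. U p)"
    using compactE_image[OF \<open>compact K\<close>, of K U] by metis
  show thesis
  proof
    show "finite (Collect ` C)" using C by simp
    show "limit_set \<F> T" if "T \<in> Collect ` C" for T
      using that C lim by blast
    show "\<exists>T\<in>Collect ` C. G T \<subseteq> S" if "S \<in> \<F>" for S
    proof -
      have "(\<lambda>x. x \<in> S) \<in> K"
        unfolding K_def using that by (intro subsetD[OF closure_subset]) blast
      then show ?thesis using C(3) unfolding U_def by fastforce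
    qed
  qed
qed

section \<open>Dickson's lemma\<close>

lemma nondecreasing_subseq_nat:
  fixes f :: "nat \<Rightarrow> nat"
  obtains r :: "nat \<Rightarrow> nat" where "strict_mono r" "incseq (\<lambda>k. f (r k))"
proof -
  obtain r :: "nat \<Rightarrow> nat" where r: "strict_mono r" "monoseq (\<lambda>k. f (r k))"
    using seq_monosub[of f] by blast
  show thesis
  proof (cases "incseq (\<lambda>k. f (r k))")
    case True then show thesis using that r by blast
  next
    case False
    then have dec: "decseq (\<lambda>k. f (r k))" using r by (auto simp: monoseq_iff)
    \<comment> \<open>A decreasing sequence is constant from an index at which its minimum is
      attained.\<close>
    obtain N where N: "\<And>k. f (r N) \<le> f (r k)"
      using ex_has_least_nat[of "\<lambda>_. True" 0 "\<lambda>k. f (r k)"] by auto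
    have "f (r (k + N)) = f (r N)" for k
      using N decseqD[OF dec, of N "k + N"] by (intro antisym) auto
    moreover have "strict_mono (\<lambda>k. r (k + N))" using r by (simp add: strict_mono_def)
    ultimately show thesis using that[of "\<lambda>k. r (k + N)"] by simp
  qed
qed

text \<open>The sequence is thinned out for one coordinate at a time; passing to a further
  subsequence keeps the earlier coordinates nondecreasing.\<close>

lemma nondecreasing_subseq_coordinates:
  fixes f :: "nat \<Rightarrow> 'i \<Rightarrow> nat"
  assumes "finite J"
  shows "\<exists>r::nat \<Rightarrow> nat. strict_mono r \<and> (\<forall>j\<in>J. incseq (\<lambda>k. f (r k) j))"
  using assms
proof (induction J)
  case empty
  show ?case by (auto intro!: exI[of _ id] simp: strict_mono_def)
next
  case (insert i J)
  then obtain r :: "nat \<Rightarrow> nat" where r: "strict_mono r" "\<And>j. j \<in> J \<Longrightarrow> incseq (\<lambda>k. f (r k) j)"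
    by blast
  obtain s :: "nat \<Rightarrow> nat" where s: "strict_mono s" "incseq (\<lambda>k. f (r (s k)) i)"
    using nondecreasing_subseq_nat[of "\<lambda>k. f (r k) i"] by blast
  have "incseq (\<lambda>k. f (r (s k)) j)" if "j \<in> J" for j
    using r(2)[OF that] s(1) by (simp add: incseq_def strict_mono_less_eq)
  then show ?case
    using r(1) s by (intro exI[of _ "\<lambda>k. r (s k)"]) (auto simp: strict_mono_def)
qed

definition nat_points :: "(real ^ 'n) set" where
  "nat_points = {x. \<forall>j. x $ j \<in> \<nat>}"

lemma nat_points_nonneg: "x \<in> nat_points \<Longrightarrow> 0 \<le> x"
  by (auto simp: nat_points_def less_eq_vec_def Nats_altdef2)

lemma nat_points_floor:
  assumes "x \<in> nat_points"
  shows "real (nat \<lfloor>x $ j\<rfloor>) = x $ j"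
proof -
  have "x $ j \<in> \<nat>" using assms by (simp add: nat_points_def)
  then show ?thesis by (auto elim: Nats_cases)
qed

lemma nat_points_eq: "nat_points = {x. 0 \<le> x} \<inter> integer_points"
  by (auto simp: nat_points_def integer_points_def less_eq_vec_def Nats_altdef2)

definition lattice_upset :: "(real ^ 'n) set \<Rightarrow> bool" where
  "lattice_upset S \<longleftrightarrow> S \<subseteq> nat_points \<and> (\<forall>x\<in>S. \<forall>y\<in>nat_points. x \<le> y \<longrightarrow> y \<in> S)"

definition minimal_points :: "'a::order set \<Rightarrow> 'a set" where
  "minimal_points S = {x\<in>S. \<forall>y\<in>S. y \<le> x \<longrightarrow> y = x}"

lemma minimal_points_subset: "minimal_points S \<subseteq> S"
  by (auto simp: minimal_points_def)

text \<open>Infinitely many minimal points would yield an injective sequence with a subsequence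
  nondecreasing in every coordinate; two of its terms are comparable, hence equal by
  minimality.\<close>

lemma finite_minimal_points:
  fixes S :: "(real ^ 'n) set"
  assumes "S \<subseteq> nat_points"
  shows "finite (minimal_points S)"
proof (rule ccontr)
  assume "infinite (minimal_points S)"
  then obtain x :: "nat \<Rightarrow> real ^ 'n" where x: "inj x" "range x \<subseteq> minimal_points S"
    using infinite_iff_countable_subset[of "minimal_points S"] by blast
  obtain r :: "nat \<Rightarrow> nat" where r: "strict_mono r"
      "\<And>j. incseq (\<lambda>k. nat \<lfloor>x (r k) $ j\<rfloor>)"
    using nondecreasing_subseq_coordinates[OF finite, of UNIV "\<lambda>k j. nat \<lfloor>x k $ j\<rfloor>"] by blast
  have nat: "real (nat \<lfloor>x k $ j\<rfloor>) = x k $ j" for k j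
    using x(2) minimal_points_subset[of S] assms by (intro nat_points_floor) blast
  have "x (r 0) \<le> x (r 1)"
    unfolding less_eq_vec_def
  proof
    fix j
    have "real (nat \<lfloor>x (r 0) $ j\<rfloor>) \<le> real (nat \<lfloor>x (r 1) $ j\<rfloor>)"
      using incseqD[OF r(2)[of j], of 0 1] by (intro of_nat_mono) simp
    then show "x (r 0) $ j \<le> x (r 1) $ j" unfolding nat .
  qed
  then have "x (r 0) = x (r 1)"
    using subsetD[OF x(2), of "x (r 0)"] subsetD[OF x(2), of "x (r 1)"]
    by (simp add: minimal_points_def)
  then show False
    using injD[OF x(1)] strict_monoD[OF r(1), of 0 1] by fastforce
qed

lemma minimal_point_below:
  fixes S :: "(real ^ 'n) set"
  assumes "S \<subseteq> nat_points" "x \<in> S"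
  obtains g where "g \<in> minimal_points S" "g \<le> x"
proof -
  \<comment> \<open>The coordinate sum, taken in \<open>nat\<close> so that it attains a least value
    on the points of \<open>S\<close> below \<open>x\<close>. On \<open>S\<close>, a strictly
    smaller vector has a strictly smaller sum.\<close>
  define h where "h y = (\<Sum>j\<in>UNIV. nat \<lfloor>y $ j\<rfloor>)" for y :: "real ^ 'n"
  obtain g where g: "g \<in> S" "g \<le> x" "\<And>y. y \<in> S \<Longrightarrow> y \<le> x \<Longrightarrow> h g \<le> h y"
    using ex_has_least_nat[of "\<lambda>y. y \<in> S \<and> y \<le> x" x h] assms by auto
  have "y = g" if y: "y \<in> S" "y \<le> g" for y
  proof (rule ccontr)
    assume "y \<noteq> g"
    then obtain i where i: "y $ i \<noteq> g $ i" by (auto simp: vec_eq_iff)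
    have N: "z $ j = real (nat \<lfloor>z $ j\<rfloor>)" if "z \<in> S" for z j
      using that assms nat_points_floor[of z j] by auto
    have le: "nat \<lfloor>y $ j\<rfloor> \<le> nat \<lfloor>g $ j\<rfloor>" for j
      using y(2) by (simp add: less_eq_vec_def floor_mono nat_mono)
    moreover have "nat \<lfloor>y $ i\<rfloor> < nat \<lfloor>g $ i\<rfloor>"
      using le[of i] i N[OF y(1), of i] N[OF g(1), of i] by (metis le_neq_implies_less)
    ultimately have "h y < h g"
      unfolding h_def by (intro sum_strict_mono_ex1) auto
    moreover have "h g \<le> h y" using g y by (meson order_trans)
    ultimately show False by simp
  qed
  then show thesis using that g by (auto simp: minimal_points_def)
qed

section \<open>Convex hulls of up-sets\<close>

lemma polyhedron_affine_slice:
  fixes K :: "('a::euclidean_space \<times> real) set"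
  assumes "polyhedron K"
  shows "polyhedron {x. (x, t) \<in> K}"
proof -
  obtain F where F: "finite F" "K = \<Inter>F" "\<And>h. h \<in> F \<Longrightarrow> \<exists>a b. a \<noteq> 0 \<and> h = {x. a \<bullet> x \<le> b}"
    using assms unfolding polyhedron_def by blast
  have "polyhedron {x. (x, t) \<in> h}" if h_F: "h \<in> F" for h
  proof -
    obtain a b where h: "h = {x. a \<bullet> x \<le> b}" using F(3)[OF h_F] by blast
    \<comment> \<open>Here \<open>fst a\<close> may vanish; the slice is then empty or the whole
      space, which is still a polyhedron.\<close>
    have "{x. (x, t) \<in> h} = {x. fst a \<bullet> x \<le> b - snd a * t}"
      unfolding h by (cases a) (auto simp: inner_Pair)
    then show ?thesis by (simp add: polyhedron_halfspace_le)
  qed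
  then have "polyhedron (\<Inter>((\<lambda>h. {x. (x, t) \<in> h}) ` F))"
    using F(1) by (intro polyhedron_Inter) auto
  moreover have "\<Inter>((\<lambda>h. {x. (x, t) \<in> h}) ` F) = {x. (x, t) \<in> K}"
    using F(2) by auto
  ultimately show ?thesis by simp
qed

text \<open>Homogenization: the set is the slice at height 1 of the cone over \<open>G \<times> {1}\<close> and \<open>E \<times> {0}\<close>.\<close>

lemma polyhedron_convex_hull_plus_cone_hull:
  fixes G E :: "'a::euclidean_space set"
  assumes "finite G" "finite E"
  shows "polyhedron {u + v |u v. u \<in> convex hull G \<and> v \<in> convex_cone hull E}" (is "polyhedron ?P")
proof (cases "G = {}")
  case True
  then show ?thesis by simp
next
  case False
  define K where "K = convex_cone hull (G \<times> {1::real} \<union> E \<times> {0::real})"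
  have "polyhedron K"
    unfolding K_def using assms by (intro polyhedron_convex_cone_hull) auto
  moreover have "{x. (x, 1) \<in> K} = ?P"
  proof -
    have "convex hull (G \<times> {1::real}) = (convex hull G) \<times> {1}"
      unfolding convex_hull_Times by simp
    then have G: "convex_cone hull (G \<times> {1::real}) = (\<Union>u\<in>convex hull G. \<Union>c\<in>{0..}. {c *\<^sub>R (u, 1)})"
      using False by (subst convex_cone_hull_convex_hull_nonempty) auto
    have "linear (\<lambda>v::'a. (v, 0::real))" by (simp add: linear_iff)
    moreover have "E \<times> {0::real} = (\<lambda>v. (v, 0)) ` E" by auto
    ultimately have E: "convex_cone hull (E \<times> {0::real}) = (\<lambda>v. (v, 0)) ` (convex_cone hull E)"
      by (metis convex_cone_hull_linear_image)
    \<comment> \<open>The cone hull of the union is the sum of the two cones. The second lies at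
      height 0, so at height 1 the factor \<open>c\<close> of the first is 1.\<close>
    show ?thesis
      unfolding K_def convex_cone_hull_Un G E by force
  qed
  ultimately show ?thesis using polyhedron_affine_slice by metis
qed

lemma nonneg_in_convex_cone_hull_Basis:
  fixes v :: "real ^ 'n"
  assumes "0 \<le> v"
  shows "v \<in> convex_cone hull Basis"
proof -
  have cone: "convex_cone (convex_cone hull (Basis :: (real ^ 'n) set))"
    by (rule convex_cone_convex_cone_hull)
  have sum: "(\<Sum>i\<in>I. f i) \<in> convex_cone hull Basis"
    if "finite I" "\<And>i. i \<in> I \<Longrightarrow> f i \<in> convex_cone hull Basis"
    for I :: "(real ^ 'n) set" and f :: "real ^ 'n \<Rightarrow> real ^ 'n"
    using that
    by (induction I rule: finite_induct)
      (auto intro: convex_cone_hull_add convex_cone_hull_contains_0)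
  have "(\<Sum>i\<in>Basis. (v \<bullet> i) *\<^sub>R i) \<in> convex_cone hull Basis"
  proof (rule sum)
    fix i :: "real ^ 'n" assume i: "i \<in> Basis"
    then have "0 \<le> v \<bullet> i"
      using assms by (auto simp: Basis_vec_def less_eq_vec_def inner_axis)
    then show "(v \<bullet> i) *\<^sub>R i \<in> convex_cone hull Basis"
      using i by (intro convex_cone_hull_mul hull_inc)
  qed simp
  then show ?thesis by (simp add: euclidean_representation)
qed

text \<open>Iteration gives the natural multiples of \<open>v\<close>. For real
  \<open>c \<ge> 0\<close> and a natural number \<open>k > c\<close>, the point
  \<open>x + c *\<^sub>R v\<close> lies on the segment from \<open>x\<close> to
  \<open>x + real k *\<^sub>R v\<close>.\<close>

lemma convex_cone_recession:
  assumes "convex S"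
  shows "convex_cone {v. \<forall>x\<in>S. x + v \<in> S}"
proof -
  have mult: "x + real k *\<^sub>R v \<in> S" if "\<forall>x\<in>S. x + v \<in> S" "x \<in> S" for x v k
    using that by (induction k) (auto simp: algebra_simps)
  have "x + c *\<^sub>R v \<in> S" if v: "\<forall>x\<in>S. x + v \<in> S" and x: "x \<in> S" and c: "0 \<le> c" for x v c
  proof -
    obtain k :: nat where k: "c < real k" using reals_Archimedean2 by blast
    have "(1 - c / real k) *\<^sub>R x + (c / real k) *\<^sub>R (x + real k *\<^sub>R v) \<in> S"
      using c k by (intro convexD[OF assms x mult[OF v x]]) auto
    also have "(1 - c / real k) *\<^sub>R x + (c / real k) *\<^sub>R (x + real k *\<^sub>R v) = x + c *\<^sub>R v"
      using c k by (simp add: algebra_simps)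
    finally show ?thesis .
  qed
  then show ?thesis
    unfolding convex_cone_iff by (auto simp flip: add.assoc)
qed

lemma lattice_upset_add_Basis:
  fixes T :: "(real ^ 'n) set"
  assumes "lattice_upset T" "x \<in> T" "e \<in> Basis"
  shows "x + e \<in> T"
proof -
  obtain i where e: "e = axis i 1"
    using assms(3) by (auto simp: Basis_vec_def)
  have "x + e \<in> nat_points"
    using assms unfolding lattice_upset_def nat_points_def e by (auto simp: axis_def)
  moreover have "x \<le> x + e" by (auto simp: less_eq_vec_def e axis_def)
  ultimately show ?thesis using assms unfolding lattice_upset_def by blast
qed

text \<open>Each point of \<open>T\<close> is a minimal point plus a nonnegative vector. Conversely,
  translation by a basis vector maps \<open>T\<close>, and so its hull, into itself; such recession
  directions form a convex cone, which therefore contains the whole orthant.\<close>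

lemma convex_hull_lattice_upset:
  fixes T :: "(real ^ 'n) set"
  assumes "lattice_upset T"
  shows "convex hull T =
    {u + v |u v. u \<in> convex hull (minimal_points T) \<and> v \<in> convex_cone hull Basis}" (is "_ = ?P")
proof
  have T: "T \<subseteq> nat_points" using assms by (simp add: lattice_upset_def)
  have "?P = (\<Union>u\<in>convex hull (minimal_points T). \<Union>v\<in>convex_cone hull Basis. {u + v})" by blast
  then have "convex ?P"
    by (simp add: convex_sums convex_convex_cone_hull)
  moreover have "T \<subseteq> ?P"
  proof
    fix x assume "x \<in> T"
    then obtain g where g: "g \<in> minimal_points T" "g \<le> x"
      using minimal_point_below[OF T] by blast
    then have "x - g \<in> convex_cone hull Basis"
      by (intro nonneg_in_convex_cone_hull_Basis) (simp add: less_eq_vec_def)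
    moreover have "x = g + (x - g)" by simp
    ultimately show "x \<in> ?P" using hull_inc[OF g(1), of convex] by blast
  qed
  ultimately show "convex hull T \<subseteq> ?P" by (rule hull_minimal[rotated])
  have "Basis \<subseteq> {v. \<forall>x\<in>convex hull T. x + v \<in> convex hull T}"
  proof clarify
    fix e x :: "real ^ 'n" assume e: "e \<in> Basis" and x: "x \<in> convex hull T"
    have "(+) e ` T \<subseteq> T"
      using lattice_upset_add_Basis[OF assms _ e] by (auto simp: add.commute)
    then have "(+) e ` (convex hull T) \<subseteq> convex hull T"
      by (metis convex_hull_translation hull_mono)
    then show "x + e \<in> convex hull T" using x by (auto simp: add.commute)
  qed
  then have "convex_cone hull Basis \<subseteq> {v. \<forall>x\<in>convex hull T. x + v \<in> convex hull T}"
    by (intro hull_minimal convex_cone_recession convex_convex_hull)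
  moreover have "convex hull (minimal_points T) \<subseteq> convex hull T"
    by (intro hull_mono minimal_points_subset)
  ultimately show "?P \<subseteq> convex hull T" by blast
qed

lemma polyhedron_convex_hull_lattice_upset:
  assumes "lattice_upset T"
  shows "polyhedron (convex hull T)"
  unfolding convex_hull_lattice_upset[OF assms] using assms
  by (intro polyhedron_convex_hull_plus_cone_hull finite_minimal_points)
    (auto simp: lattice_upset_def)

text \<open>A separating normal is nonnegative because \<open>T\<close> is closed under unit steps;
  a small multiple of the all-ones vector then makes it positive. Strict positivity leaves only
  finitely many lattice points outside the halfspace.\<close>

lemma separate_from_lattice_upset:
  fixes T :: "(real ^ 'n) set"
  assumes T: "lattice_upset T" and x: "x \<notin> convex hull T"
  obtains a \<alpha> where "\<And>j. 0 < a $ j" "a \<bullet> x < \<alpha>" "\<And>y. y \<in> T \<Longrightarrow> \<alpha> \<le> a \<bullet> y"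
proof -
  have "closed (convex hull T)"
    using T by (intro polyhedron_imp_closed polyhedron_convex_hull_lattice_upset)
  then obtain a \<alpha> where a: "(\<forall>j. 0 \<le> a $ j)" "a \<bullet> x < \<alpha>" "\<And>y. y \<in> T \<Longrightarrow> \<alpha> \<le> a \<bullet> y"
  proof (cases "T = {}")
    case True
    \<comment> \<open>Validity on the empty set is vacuous, so the normal 0 with bound 1
      separates.\<close>
    then show thesis using that[of 0 1] by simp
  next
    case False
    then obtain g where g: "g \<in> T" by blast
    obtain a \<alpha> where a: "a \<bullet> x < \<alpha>" "\<And>y. y \<in> convex hull T \<Longrightarrow> \<alpha> < a \<bullet> y"
      using separating_hyperplane_closed_point[OF convex_convex_hull \<open>closed (convex hull T)\<close> x]
      by blast
    have "0 \<le> a $ j" for j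
    proof (rule ccontr)
      assume neg: "\<not> 0 \<le> a $ j"
      \<comment> \<open>If \<open>a $ j\<close> were negative, walking from \<open>g\<close> along
        axis \<open>j\<close> would push \<open>a \<bullet> y\<close> below \<open>\<alpha>\<close>
        inside \<open>T\<close>.\<close>
      have "g + real k *\<^sub>R axis j 1 \<in> T" for k
      proof (induction k)
        case (Suc k)
        then show ?case
          using lattice_upset_add_Basis[OF T Suc, of "axis j 1"]
          by (auto simp: algebra_simps axis_in_Basis_iff)
      qed (simp add: g)
      then have *: "\<alpha> < a \<bullet> g + real k * a $ j" for k
        using a(2)[OF hull_inc, of "g + real k *\<^sub>R axis j 1"] by (simp add: inner_add_right inner_axis)
      obtain k :: nat where "(a \<bullet> g - \<alpha>) / (- a $ j) < real k" using reals_Archimedean2 by blast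
      then have "a \<bullet> g - \<alpha> < real k * (- a $ j)" using neg by (subst (asm) pos_divide_less_eq) auto
      then show False using *[of k] by simp
    qed
    then show thesis using that a hull_inc by (meson less_imp_le)
  qed
  define s where "s = (\<Sum>j\<in>UNIV. \<bar>x $ j\<bar>)"
  have "0 \<le> s" by (simp add: s_def sum_nonneg)
  \<comment> \<open>Small enough that the perturbation raises the value at \<open>x\<close> by less
    than the gap \<open>\<alpha> - a \<bullet> x\<close>; the \<open>+ 1\<close> keeps the
    denominator positive when \<open>x = 0\<close>. On \<open>T\<close> the perturbation can only
    raise values.\<close>
  define \<epsilon> where "\<epsilon> = (\<alpha> - a \<bullet> x) / (s + 1)"
  have \<epsilon>: "0 < \<epsilon>" using a(2) \<open>0 \<le> s\<close> by (simp add: \<epsilon>_def)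
  define c where "c = a + \<epsilon> *\<^sub>R (1 :: real ^ 'n)"
  have c: "c \<bullet> y = a \<bullet> y + \<epsilon> * (\<Sum>j\<in>UNIV. y $ j)" for y
    by (simp add: c_def inner_add_left) (simp add: inner_vec_def)
  show thesis
  proof
    show "0 < c $ j" for j using a(1) \<epsilon> by (simp add: c_def add_nonneg_pos)
    have "\<epsilon> * (\<Sum>j\<in>UNIV. x $ j) \<le> \<epsilon> * s"
      using \<epsilon> unfolding s_def by (intro mult_left_mono sum_mono) auto
    also have "\<dots> < \<epsilon> * (s + 1)" using \<epsilon> by simp
    also have "\<dots> = \<alpha> - a \<bullet> x" using \<open>0 \<le> s\<close> by (simp add: \<epsilon>_def)
    finally show "c \<bullet> x < \<alpha>" by (simp add: c)
    fix y assume y: "y \<in> T"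
    then have "0 \<le> y" using T nat_points_nonneg by (auto simp: lattice_upset_def)
    then have "0 \<le> \<epsilon> * (\<Sum>j\<in>UNIV. y $ j)"
      using \<epsilon> by (intro mult_nonneg_nonneg sum_nonneg) (auto simp: less_eq_vec_def)
    then show "\<alpha> \<le> c \<bullet> y" using a(3)[OF y] by (simp add: c)
  qed
qed

text \<open>All summands of \<open>a \<bullet> y\<close> are nonnegative, so
  \<open>y $ j \<le> \<alpha> / a $ j\<close> and the points lie in a finite box of lattice
  points.\<close>

lemma finite_nat_points_below:
  fixes a :: "real ^ 'n"
  assumes "\<And>j. 0 < a $ j"
  shows "finite {y \<in> nat_points. a \<bullet> y < \<alpha>}"
proof -
  define N where "N = nat \<lceil>Max (range (\<lambda>j. \<alpha> / a $ j))\<rceil>"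
  have N: "\<alpha> / a $ j \<le> real N" for j
  proof -
    have "\<alpha> / a $ j \<le> Max (range (\<lambda>j. \<alpha> / a $ j))" by (intro Max_ge) auto
    also have "\<dots> \<le> real N" unfolding N_def by linarith
    finally show ?thesis .
  qed
  have "{y \<in> nat_points. a \<bullet> y < \<alpha>} \<subseteq>
      (\<lambda>f. \<chi> j. real (f j)) ` (PiE UNIV (\<lambda>j::'n. {..N}))"
  proof clarify
    fix y :: "real ^ 'n" assume y: "y \<in> nat_points" "a \<bullet> y < \<alpha>"
    define f where "f j = nat \<lfloor>y $ j\<rfloor>" for j
    have f: "y $ j = real (f j)" for j
      using nat_points_floor[OF y(1)] by (simp add: f_def)
    have "f j \<le> N" for j
    proof -
      have "a $ j * y $ j \<le> (\<Sum>j\<in>UNIV. a $ j * y $ j)"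
        using assms f by (intro member_le_sum) (auto simp: less_imp_le)
      also have "\<dots> < \<alpha>" using y(2) by (simp add: inner_vec_def)
      finally have "y $ j \<le> \<alpha> / a $ j"
        using assms[of j] by (simp add: pos_le_divide_eq mult.commute)
      then show ?thesis using N[of j] f[of j] by simp
    qed
    then show "y \<in> (\<lambda>f. \<chi> j. real (f j)) ` (PiE UNIV (\<lambda>j::'n. {..N}))"
      using f by (intro image_eqI[of _ _ f]) (auto simp: vec_eq_iff)
  qed
  then show ?thesis by (rule finite_subset) (intro finite_imageI finite_PiE; simp)
qed

section \<open>Intersections of hulls of up-sets\<close>

text \<open>Each condition on an up-set involves at most two points, so it passes from a member of
  \<open>\<F>\<close> agreeing with \<open>T\<close> on those points.\<close>

lemma lattice_upset_limit_set:
  assumes \<F>: "\<And>S. S \<in> \<F> \<Longrightarrow> lattice_upset S" and T: "limit_set \<F> T"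
  shows "lattice_upset T"
  unfolding lattice_upset_def
proof (intro conjI subsetI ballI impI)
  fix x assume "x \<in> T"
  obtain S where "S \<in> \<F>" "S \<inter> {x} = T \<inter> {x}" by (rule limit_setE[OF T, of "{x}"]) auto
  then show "x \<in> nat_points" using \<F> \<open>x \<in> T\<close> unfolding lattice_upset_def by blast
next
  fix x y assume "x \<in> T" "y \<in> nat_points" "x \<le> y"
  obtain S where S: "S \<in> \<F>" "S \<inter> {x, y} = T \<inter> {x, y}"
    by (rule limit_setE[OF T, of "{x, y}"]) auto
  then have "x \<in> S" using \<open>x \<in> T\<close> by blast
  then have "y \<in> S"
    using \<F>[OF S(1)] \<open>y \<in> nat_points\<close> \<open>x \<le> y\<close> unfolding lattice_upset_def by blast
  then show "y \<in> T" using S(2) by blast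
qed

lemma Inter_convex_hull_subset_limit:
  fixes T :: "(real ^ 'n) set"
  assumes \<F>: "\<And>S. S \<in> \<F> \<Longrightarrow> lattice_upset S" and T: "limit_set \<F> T"
  shows "(\<Inter>S\<in>\<F>. convex hull S) \<subseteq> convex hull T"
proof
  fix x assume x: "x \<in> (\<Inter>S\<in>\<F>. convex hull S)"
  show "x \<in> convex hull T"
  proof (rule ccontr)
    assume "x \<notin> convex hull T"
    then obtain a \<alpha> where a: "\<And>j. 0 < a $ j" "a \<bullet> x < \<alpha>" "\<And>y. y \<in> T \<Longrightarrow> \<alpha> \<le> a \<bullet> y"
      using separate_from_lattice_upset[OF lattice_upset_limit_set[OF \<F> T]] by metis
    obtain S where S: "S \<in> \<F>"
        "S \<inter> {y \<in> nat_points. a \<bullet> y < \<alpha>} = T \<inter> {y \<in> nat_points. a \<bullet> y < \<alpha>}"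
      using limit_setE[OF T finite_nat_points_below[OF a(1)]] by blast
    \<comment> \<open>\<open>T\<close> has no point violating the inequality, and \<open>S\<close>
      agrees with \<open>T\<close> on all lattice points that violate it.\<close>
    have "S \<subseteq> {y. \<alpha> \<le> a \<bullet> y}"
      using \<F>[OF S(1)] S(2) a(3) unfolding lattice_upset_def by fastforce
    then have "convex hull S \<subseteq> {y. \<alpha> \<le> a \<bullet> y}"
      by (intro hull_minimal convex_halfspace_ge)
    then show False using x S(1) a(2) by force
  qed
qed

text \<open>The finitely many limits in \<open>\<T>\<close> give the same intersection of hulls as
  \<open>\<F>\<close>: each member of \<open>\<F>\<close> contains one of them, and the hull of each
  of them contains the intersection over \<open>\<F>\<close>.\<close>

theorem polyhedron_Inter_convex_hull_lattice_upsets: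
  fixes \<F> :: "(real ^ 'n) set set"
  assumes \<F>: "\<And>S. S \<in> \<F> \<Longrightarrow> lattice_upset S"
  shows "polyhedron (\<Inter>S\<in>\<F>. convex hull S)"
proof -
  have upset: "lattice_upset T" if "limit_set \<F> T" for T
    using \<F> that by (rule lattice_upset_limit_set)
  then have "finite (minimal_points T) \<and> minimal_points T \<subseteq> T" if "limit_set \<F> T" for T
    using that by (simp add: finite_minimal_points minimal_points_subset lattice_upset_def)
  then obtain \<T> where \<T>: "finite \<T>" "\<And>T. T \<in> \<T> \<Longrightarrow> limit_set \<F> T"
      "\<And>S. S \<in> \<F> \<Longrightarrow> \<exists>T\<in>\<T>. minimal_points T \<subseteq> S"
    using finite_limits_below by metis
  have "(\<Inter>T\<in>\<T>. convex hull T) \<subseteq> convex hull S" if S: "S \<in> \<F>" for S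
  proof -
    obtain T where T: "T \<in> \<T>" "minimal_points T \<subseteq> S" using \<T>(3)[OF S] by blast
    have "T \<subseteq> S"
    proof
      fix x assume x: "x \<in> T"
      have TN: "T \<subseteq> nat_points" using upset[OF \<T>(2)[OF T(1)]] by (simp add: lattice_upset_def)
      then obtain g where "g \<in> minimal_points T" "g \<le> x" using x minimal_point_below by blast
      then show "x \<in> S" using T(2) TN x \<F>[OF S] unfolding lattice_upset_def by blast
    qed
    then show ?thesis using T(1) hull_mono by blast
  qed
  moreover have "(\<Inter>S\<in>\<F>. convex hull S) \<subseteq> convex hull T" if "T \<in> \<T>" for T
    using \<F> \<T>(2)[OF that] by (rule Inter_convex_hull_subset_limit)
  ultimately have "(\<Inter>S\<in>\<F>. convex hull S) = (\<Inter>T\<in>\<T>. convex hull T)" by blast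
  moreover have "polyhedron (\<Inter>T\<in>\<T>. convex hull T)"
    using \<T> upset by (intro polyhedron_Inter) (auto intro: polyhedron_convex_hull_lattice_upset)
  ultimately show ?thesis by simp
qed

section \<open>Application to aggregated covering systems\<close>

lemma lattice_upset_aggregated_region:
  fixes A :: "real ^ 'n ^ 'm"
  assumes "\<And>i j. 0 \<le> A $ i $ j" "0 \<le> l"
  shows "lattice_upset (aggregated_region A b l \<inter> integer_points)"
proof -
  \<comment> \<open>Nonnegative coefficients make the aggregated left-hand side monotone in
    \<open>x\<close>.\<close>
  have "0 \<le> (l v* A) $ j" for j
    using assms by (auto simp: vector_matrix_mult_def less_eq_vec_def intro!: sum_nonneg)
  then have "(l v* A) \<bullet> x \<le> (l v* A) \<bullet> y" if "x \<le> y" for x y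
    using that by (auto simp: inner_vec_def less_eq_vec_def intro!: sum_mono mult_left_mono)
  then show ?thesis
    unfolding lattice_upset_def nat_points_eq aggregated_region_def by fastforce
qed

theorem theorem3:
  fixes A :: "int ^ 'n ^ 'm" and b :: "int ^ 'm"
  assumes "\<And>i j. 0 \<le> A $ i $ j"
    and "\<And>i. 0 < b $ i"
  shows "polyhedron (aggregation_closure (real_mat A) (real_vec b))"
proof -
  define \<F> where "\<F> =
    (\<lambda>l. aggregated_region (real_mat A) (real_vec b) l \<inter> integer_points) ` {l. 0 \<le> l}"
  have "lattice_upset S" if "S \<in> \<F>" for S
    using that assms(1) unfolding \<F>_def
    by (auto intro!: lattice_upset_aggregated_region simp: real_mat_def)
  then have "polyhedron (\<Inter>S\<in>\<F>. convex hull S)"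
    by (rule polyhedron_Inter_convex_hull_lattice_upsets)
  then show ?thesis
    by (simp add: \<F>_def aggregation_closure_def)
qed

end
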